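(* For every integer $k \geq 3$ there exists a finite groupoid $\langle G, \star\rangle$ that is $k$-antiassociative.
   Context: A groupoid $\langle G,\star\rangle$ is a nonempty set $G$ with a single binary operation $\star$ (no axioms assumed). Ordered terms are defined inductively: a single variable $x_j$ is a $1$-ary ordered term on $x_j$; if $t_1$ is an ordered term on the variables $x_j,\dots,x_{j+k_1-1}$ and $t_2$ is an ordered term on the variables $x_{j+k_1},\dots,x_{j+k_1+k_2-1}$, then $t_1\star t_2$ is a $(k_1+k_2)$-ary ordered term on $x_j,\dots,x_{j+k_1+k_2-1}$. Thus the ordered terms on $x_1,\dots,x_k$ are the formal expressions obtained by fully parenthesizing $x_1\star x_2\star\cdots\star x_k$. A groupoid $\langle G,\star\rangle$ separates two terms $s(x_1,\dots,x_k)$ and $t(x_1,\dots,x_k)$ if $s(x_1,\dots,x_k)\neq t(x_1,\dots,x_k)$ in $G$ for all $x_1,\dots,x_k\in G$. The groupoid is $k$-antiassociative if it separates every pair of distinct (as formal expressions) ordered terms on $x_1,\dots,x_k$. *)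

theory Defs
  imports Main "HOL-Library.FuncSet"
begin

locale groupoid =
  fixes G :: "'a set" and star :: "'a \<Rightarrow> 'a \<Rightarrow> 'a" (infixl "\<star>" 70)
  assumes nonempty: "G \<noteq> {}"
    and closed: "\<lbrakk>a \<in> G; b \<in> G\<rbrakk> \<Longrightarrow> a \<star> b \<in> G"

datatype trm = Var nat | Star trm trm

text \<open>\<open>ordered_term j k t\<close>: \<open>t\<close> is a \<open>k\<close>-ary ordered term on
  $x_j, \dots, x_{j+k-1}$.\<close>

inductive ordered_term :: "nat \<Rightarrow> nat \<Rightarrow> trm \<Rightarrow> bool" where
  var: "ordered_term j 1 (Var j)"
| star: "\<lbrakk>ordered_term j k\<^sub>1 t\<^sub>1; ordered_term (j + k\<^sub>1) k\<^sub>2 t\<^sub>2\<rbrakk>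
    \<Longrightarrow> ordered_term j (k\<^sub>1 + k\<^sub>2) (Star t\<^sub>1 t\<^sub>2)"

primrec eval_trm :: "('a \<Rightarrow> 'a \<Rightarrow> 'a) \<Rightarrow> (nat \<Rightarrow> 'a) \<Rightarrow> trm \<Rightarrow> 'a" where
  "eval_trm f x (Var i) = x i"
| "eval_trm f x (Star s t) = f (eval_trm f x s) (eval_trm f x t)"

context groupoid
begin

definition separates :: "nat \<Rightarrow> trm \<Rightarrow> trm \<Rightarrow> bool" where
  "separates k s t \<longleftrightarrow>
     (\<forall>x \<in> {1..k} \<rightarrow> G. eval_trm (\<star>) x s \<noteq> eval_trm (\<star>) x t)"

definition antiassociative :: "nat \<Rightarrow> bool" where
  "antiassociative k \<longleftrightarrow>
     (\<forall>s t. ordered_term 1 k s \<longrightarrow> ordered_term 1 k t \<longrightarrow> s \<noteq> t \<longrightarrow> separates k s t)"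

end

end

theory Submission
  imports Defs "HOL-Library.Countable_Set"
begin

text \<open>
  Elements are complete binary trees of bounded height with labels in \<open>\<int>/K\<close>. The product of
  \<open>a\<close> and \<open>b\<close> is the tree with subtrees \<open>a\<close> and \<open>b\<close>, truncated at the bottom, whose root label
  is that of \<open>a\<close> plus one. Hence the root label of the value of a term is that of its first
  variable plus the depth of that variable, and the label at an address is the root label of
  the subterm at this address. For two distinct ordered terms on the same variables, descend to
  the first difference, always to the left if the left subterms differ and to the right
  otherwise. The two subterms reached start with the same variable, exactly one of them is this
  variable, and therefore their root labels differ.
\<close>

definition addresses :: "nat \<Rightarrow> bool list set" where
  "addresses K = {w. length w < K}"

definition label_trees :: "nat \<Rightarrow> (bool list \<Rightarrow> nat) set" where
  "label_trees K = addresses K \<rightarrow>\<^sub>E {..<K}"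

text \<open>In an address, \<open>True\<close> goes left and \<open>False\<close> goes right. The
  restriction to \<open>addresses K\<close> is the truncation.\<close>

definition join :: "nat \<Rightarrow> (bool list \<Rightarrow> nat) \<Rightarrow> (bool list \<Rightarrow> nat) \<Rightarrow> bool list \<Rightarrow> nat" where
  "join K a b = (\<lambda>w\<in>addresses K.
     case w of [] \<Rightarrow> (a [] + 1) mod K | c # v \<Rightarrow> (if c then a else b) v)"

lemma finite_addresses: "finite (addresses K)"
  by (rule finite_subset[OF _ finite_lists_length_le[OF finite_UNIV, of K]])
    (auto simp: addresses_def)

lemma finite_label_trees: "finite (label_trees K)"
  by (simp add: label_trees_def finite_addresses finite_PiE)

lemma label_trees_nonempty: "K > 0 \<Longrightarrow> label_trees K \<noteq> {}"
  by (auto simp: label_trees_def PiE_eq_empty_iff)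

lemma join_closed:
  "K > 0 \<Longrightarrow> a \<in> label_trees K \<Longrightarrow> b \<in> label_trees K \<Longrightarrow> join K a b \<in> label_trees K"
  unfolding label_trees_def join_def
  by (intro restrict_PiE_iff[THEN iffD2] ballI)
    (auto simp: addresses_def PiE_def Pi_def split: list.split)

lemma join_Nil: "K > 0 \<Longrightarrow> join K a b [] = (a [] + 1) mod K"
  by (simp add: join_def addresses_def)

lemma join_Cons: "Suc (length v) < K \<Longrightarrow> join K a b (c # v) = (if c then a else b) v"
  by (simp add: join_def addresses_def)

lemma ordered_term_pos: "ordered_term j n t \<Longrightarrow> n > 0"
  by (induction rule: ordered_term.induct) auto

lemma ordered_term_VarE:
  assumes "ordered_term j n (Var i)" obtains "i = j" "n = 1"
  using assms by (auto elim: ordered_term.cases)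

lemma ordered_term_StarE:
  assumes "ordered_term j n (Star t u)"
  obtains n1 n2 where "n = n1 + n2" "ordered_term j n1 t" "ordered_term (j + n1) n2 u"
    "n1 > 0" "n2 > 0"
  using assms(1)
proof cases
  case (star k1 k2)
  then show thesis
    using that ordered_term_pos by blast
qed

lemma ordered_term_arity_unique:
  "ordered_term j m t \<Longrightarrow> ordered_term j n t \<Longrightarrow> m = n"
proof (induction arbitrary: n rule: ordered_term.induct)
  case (var j)
  then show ?case by (auto elim: ordered_term_VarE)
next
  case (star j k1 t1 k2 t2)
  from star.prems show ?case
    by (rule ordered_term_StarE) (use star.IH in auto)
qed

lemma eval_root_label:
  assumes "ordered_term j n t" "K > 0" "x j [] < K"
  shows "\<exists>l<n. (l = 0 \<longleftrightarrow> t = Var j) \<and> eval_trm (join K) x t [] = (x j [] + l) mod K"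
  using assms
proof (induction rule: ordered_term.induct)
  case (var j)
  then show ?case by auto
next
  case (star j k1 t1 k2 t2)
  then obtain l where l: "l < k1" "eval_trm (join K) x t1 [] = (x j [] + l) mod K"
    by auto
  \<comment> \<open>Passing to the left factor drops at least one variable, so \<open>Suc l\<close>
    stays below \<open>k1 + k2\<close>.\<close>
  have "k2 > 0"
    using star.hyps ordered_term_pos by blast
  with l star.prems show ?case
    by (intro exI[of _ "Suc l"]) (simp add: join_Nil mod_Suc_eq)
qed

text \<open>The depth of the first variable lies strictly between 0 and \<open>K\<close>, so adding
  it modulo \<open>K\<close> moves every label.\<close>

lemma root_labels_differ:
  assumes "ordered_term j n t" "t \<noteq> Var j" "n \<le> K" "x j [] < K"
  shows "eval_trm (join K) x t [] \<noteq> x j []"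
proof -
  have "K > 0"
    using assms(4) by simp
  from eval_root_label[OF assms(1) this, of x] assms obtain l where
    l: "0 < l" "l < K" and eq: "eval_trm (join K) x t [] = (x j [] + l) mod K"
    by fastforce
  have "(x j [] + l) mod K \<noteq> x j []"
  proof (cases "x j [] + l < K")
    case False
    then show ?thesis
      using l assms(4) by (auto simp: mod_if)
  qed (use l in simp)
  then show ?thesis
    using eq by simp
qed

text \<open>The arities may differ because the left factors of two terms of equal arity need not
  have equal arity. The bound on the address is what lets it survive truncation.\<close>

lemma labels_differ:
  assumes "ordered_term j m s" "ordered_term j n t" "s \<noteq> t" "m \<le> K" "n \<le> K"
    and x: "\<And>i. x i [] < K"
  shows "\<exists>w. length w < max m n \<and> eval_trm (join K) x s w \<noteq> eval_trm (join K) x t w"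
  using assms(1-5)
proof (induction s arbitrary: j m n t rule: trm.induct)
  case (Var i)
  then have "i = j" and "m = 1"
    by (auto elim: ordered_term_VarE)
  moreover have "eval_trm (join K) x t [] \<noteq> x j []"
    using Var \<open>i = j\<close> x by (intro root_labels_differ[of j n]) auto
  ultimately show ?case
    by (intro exI[of _ "[]"]) auto
next
  case (Star s1 s2)
  show ?case
  proof (cases t)
    case (Var i)
    then have "i = j"
      using Star.prems(2) by (auto elim: ordered_term_VarE)
    moreover have "eval_trm (join K) x (Star s1 s2) [] \<noteq> x j []"
      using Star.prems x by (intro root_labels_differ) auto
    moreover have "m > 0"
      using Star.prems(1) by (rule ordered_term_pos)
    ultimately show ?thesis
      using Var by (intro exI[of _ "[]"]) auto
  next
    case t: (Star t1 t2)
    from Star.prems(1) obtain m1 m2 where m: "m = m1 + m2" "ordered_term j m1 s1"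
      "ordered_term (j + m1) m2 s2" "m1 > 0" "m2 > 0"
      by (rule ordered_term_StarE)
    from Star.prems(2)[unfolded t] obtain n1 n2 where n: "n = n1 + n2" "ordered_term j n1 t1"
      "ordered_term (j + n1) n2 t2" "n1 > 0" "n2 > 0"
      by (rule ordered_term_StarE)
    show ?thesis
    proof (cases "s1 = t1")
      case False
      then obtain w where "length w < max m1 n1"
        "eval_trm (join K) x s1 w \<noteq> eval_trm (join K) x t1 w"
        using Star.IH(1)[OF m(2) n(2)] m(1) n(1) Star.prems(4,5) by auto
      then show ?thesis
        \<comment> \<open>The right factors have positive arity, so the address, longer by one, is
          still shorter than \<open>max m n\<close>, hence than \<open>K\<close>.\<close>
        using t m n Star.prems(4,5) by (intro exI[of _ "True # w"]) (auto simp: join_Cons)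
    next
      case True
      \<comment> \<open>Equal left factors make both right factors start at the same variable, as
        the induction hypothesis requires.\<close>
      then have "m1 = n1"
        using m(2) n(2) ordered_term_arity_unique by blast
      then obtain w where "length w < max m2 n2"
        "eval_trm (join K) x s2 w \<noteq> eval_trm (join K) x t2 w"
        using Star.IH(2)[OF m(3), of n2 t2] n m(1) t True Star.prems(3-5) by auto
      then show ?thesis
        using t m n Star.prems(4,5) by (intro exI[of _ "False # w"]) (auto simp: join_Cons)
    qed
  qed
qed

text \<open>This carries the inequality from trees over to their codes in the naturals.\<close>

lemma eval_trm_hom:
  assumes "\<And>a b. g (f a b) = f' (g a) (g b)"
  shows "g (eval_trm f x t) = eval_trm f' (g \<circ> x) t"
  by (induction t) (simp_all add: assms)

theorem theorem3p5:
  fixes k :: nat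
  assumes "k \<ge> 3"
  shows "\<exists>(G :: nat set) star. finite G \<and> groupoid G star \<and> groupoid.antiassociative G star k"
proof -
  define T where "T = label_trees k"
  define dec where "dec = from_nat_into T"
  define G where "G = to_nat_on T ` T"
  define star where "star a b = to_nat_on T (join k (dec a) (dec b))" for a b
  have "k > 0"
    using assms by simp
  have "finite T" "T \<noteq> {}"
    using \<open>k > 0\<close> by (simp_all add: T_def finite_label_trees label_trees_nonempty)
  \<comment> \<open>Numbers outside \<open>G\<close> decode to trees too, so the root labels are
    below \<open>k\<close> for every assignment.\<close>
  have dec_in: "dec n \<in> T" for n
    using \<open>T \<noteq> {}\<close> by (simp add: dec_def from_nat_into)
  have join_in: "join k (dec a) (dec b) \<in> T" for a b
    using dec_in \<open>k > 0\<close> by (simp add: T_def join_closed)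
  have dec_star: "dec (star a b) = join k (dec a) (dec b)" for a b
    using join_in \<open>finite T\<close>
    by (simp add: star_def dec_def countable_finite)
  interpret groupoid G star
    using \<open>T \<noteq> {}\<close> join_in by unfold_locales (auto simp: G_def star_def)
  have "antiassociative k"
    unfolding antiassociative_def separates_def
  proof (intro allI impI ballI)
    fix s t and x :: "nat \<Rightarrow> nat"
    assume "ordered_term 1 k s" "ordered_term 1 k t" "s \<noteq> t"
    moreover have "(dec \<circ> x) i [] < k" for i
      using dec_in[of "x i"] \<open>k > 0\<close> by (auto simp: T_def label_trees_def addresses_def)
    ultimately have "eval_trm (join k) (dec \<circ> x) s \<noteq> eval_trm (join k) (dec \<circ> x) t"
      using labels_differ[of 1 k s k t k "dec \<circ> x"] by auto
    then show "eval_trm star x s \<noteq> eval_trm star x t"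
      using eval_trm_hom[of dec star "join k", OF dec_star] by metis
  qed
  then show ?thesis
    using \<open>finite T\<close> groupoid_axioms by (intro exI[of _ G] exI[of _ star]) (simp add: G_def)
qed

end
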